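(* Let $V$ be a nonempty word on any alphabet and fix an integer $q \geq 2$. The following are equivalent: (i) $V$ is doubled (that is, every letter occurring in $V$ occurs at least twice); (ii) $\delta(V,q)=0$, i.e. $\lim_{n\to\infty}\delta_n(V,q)=0$.
   Context: $[q]=\{1,\dots,q\}$ and $[q]^n$ is the set of words of length $n$ over $[q]$. A word $U$ is an instance of a word $V$ (a $V$-instance) if $U=\phi(V)$ for some homomorphism $\phi$ of free monoids that is nonerasing (no letter is mapped to the empty word). For a word $W$ and $0\le i<j\le |W|$, $W[i,j]$ denotes the factor consisting of the $j-i$ consecutive letters of $W$ beginning with the $(i+1)$-th. For nonempty words $V,W$, the density of $V$ in $W$ is $$\delta(V,W)=\frac{|\{(i,j):0\le i<j\le|W|,\ W[i,j]\text{ is a }V\text{-instance}\}|}{\binom{|W|+1}{2}}.$$ The expected density is $\delta_n(V,q)=\mathbb{E}(\delta(V,W_n))$ with $W_n\in[q]^n$ chosen uniformly at random, and $\delta(V,q)=\lim_{n\to\infty}\delta_n(V,q)$. *)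

theory Defs
  imports "HOL-Probability.Probability"
begin

text \<open>Words over an alphabet are lists; lists under concatenation are the free monoid.\<close>

definition free_monoid_hom :: "('a list \<Rightarrow> 'b list) \<Rightarrow> bool" where
  "free_monoid_hom \<phi> \<longleftrightarrow> \<phi> [] = [] \<and> (\<forall>u v. \<phi> (u @ v) = \<phi> u @ \<phi> v)"

definition nonerasing :: "('a list \<Rightarrow> 'b list) \<Rightarrow> bool" where
  "nonerasing \<phi> \<longleftrightarrow> (\<forall>a. \<phi> [a] \<noteq> [])"

text \<open>Letters of the type that do not occur in \<open>V\<close>, and the values of the homomorphism at them,
  play no role: any nonerasing homomorphism on the words over the letters of \<open>V\<close> extends
  to all of \<open>'a list\<close>.\<close>

definition word_instance :: "'a list \<Rightarrow> 'b list \<Rightarrow> bool" where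
  "word_instance V U \<longleftrightarrow> (\<exists>\<phi>. free_monoid_hom \<phi> \<and> nonerasing \<phi> \<and> U = \<phi> V)"

definition word_factor :: "'b list \<Rightarrow> nat \<Rightarrow> nat \<Rightarrow> 'b list" where
  "word_factor W i j = take (j - i) (drop i W)"

text \<open>Only nonempty \<open>W\<close> matter; for \<open>W = []\<close> the quotient is \<open>0 / 0 = 0\<close>.\<close>

definition word_density :: "'a list \<Rightarrow> 'b list \<Rightarrow> real" where
  "word_density V W =
     real (card {(i, j). i < j \<and> j \<le> length W \<and> word_instance V (word_factor W i j)})
       / real ((length W + 1) choose 2)"

definition words_of_length :: "nat \<Rightarrow> nat \<Rightarrow> nat list set" where
  "words_of_length q n = {W. set W \<subseteq> {1..q} \<and> length W = n}"

definition expected_density :: "'a list \<Rightarrow> nat \<Rightarrow> nat \<Rightarrow> real" where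
  "expected_density V q n =
     measure_pmf.expectation (pmf_of_set (words_of_length q n)) (\<lambda>W. word_density V W)"

definition doubled :: "'a list \<Rightarrow> bool" where
  "doubled V \<longleftrightarrow> (\<forall>a\<in>set V. count_list V a \<ge> 2)"

end

theory Submission
  imports Defs
begin

text \<open>
  Let \<open>p m\<close> be the probability that a uniformly random word of length \<open>m\<close> over \<open>q\<close> letters is a
  \<open>V\<close>-instance.  Every factor of a uniformly random word is itself uniformly random, so by linearity
  of expectation the expected density at length \<open>n\<close> is the average of \<open>p (j - i)\<close> over all pairs
  \<open>i < j \<le> n\<close> (\<open>expected_density_eq_avg\<close>).  It remains to see how large \<open>p m\<close> is.

  If \<open>V\<close> is doubled, then even \<open>\<Sum>m\<ge>1. p m \<le> 1\<close> (\<open>doubled_imp_sum_instance_prob_le_1\<close>).  Indeed,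
  this series is the sum of \<open>(1/q) ^ length U\<close> over all nonempty instances \<open>U\<close> over the \<open>q\<close>
  letters, and each of them is obtained by substituting nonempty words for the letters of \<open>V\<close>.
  Summing over substitutions instead, the sum factors over the letters, and a letter occurring \<open>c \<ge> 2\<close> times contributes
  \<open>\<Sum>l\<ge>1. q ^ l * (1/q) ^ (c * l) \<le> \<Sum>l\<ge>1. (1/q) ^ l \<le> 1\<close>.  For each of the \<open>n\<close> possible left ends
  \<open>i\<close> the factors starting there thus contribute at most 1, and the density is at most
  \<open>n / (n + 1 choose 2) = 2 / (n + 1)\<close>.

  If \<open>V = A @ [a] @ B\<close> where \<open>a\<close> occurs only once, then every word consisting of \<open>length A\<close> copies
  of the letter 1, an arbitrary nonempty word, and \<open>length B\<close> copies of 1 is an instance, so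
  \<open>p m \<ge> (1/q) ^ length V\<close> for all \<open>m \<ge> length V\<close> (\<open>not_doubled_imp_instance_prob_ge\<close>).  As a
  positive proportion of the factors of a long word is long, the density stays away from 0.
\<close>

section \<open>Instances as substitutions\<close>

lemma free_monoid_hom_eq_concat_map:
  assumes "free_monoid_hom \<phi>"
  shows "\<phi> u = concat (map (\<lambda>a. \<phi> [a]) u)"
proof (induction u)
  case Nil
  then show ?case using assms by (simp add: free_monoid_hom_def)
next
  case (Cons a u)
  have "\<phi> (a # u) = \<phi> ([a] @ u)" by simp
  also have "\<dots> = \<phi> [a] @ \<phi> u" using assms unfolding free_monoid_hom_def by blast
  finally show ?case using Cons by simp
qed

lemma word_instance_iff:
  "word_instance V U \<longleftrightarrow> (\<exists>f. (\<forall>a. f a \<noteq> []) \<and> U = concat (map f V))"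
proof
  assume "word_instance V U"
  then obtain \<phi> where "free_monoid_hom \<phi>" "\<forall>a. \<phi> [a] \<noteq> []" "U = \<phi> V"
    by (auto simp: word_instance_def nonerasing_def)
  then have "(\<forall>a. \<phi> [a] \<noteq> []) \<and> U = concat (map (\<lambda>a. \<phi> [a]) V)"
    using free_monoid_hom_eq_concat_map[of \<phi> V] by simp
  then show "\<exists>f. (\<forall>a. f a \<noteq> []) \<and> U = concat (map f V)"
    by (rule exI[of _ "\<lambda>a. \<phi> [a]"])
next
  assume "\<exists>f. (\<forall>a. f a \<noteq> []) \<and> U = concat (map f V)"
  then obtain f where f: "\<forall>a. f a \<noteq> []" "U = concat (map f V)" by blast
  have "free_monoid_hom (\<lambda>u. concat (map f u))" by (simp add: free_monoid_hom_def)
  moreover have "nonerasing (\<lambda>u. concat (map f u))" using f(1) by (simp add: nonerasing_def)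
  ultimately show "word_instance V U" unfolding word_instance_def using f(2) by blast
qed

lemma length_concat_map:
  "length (concat (map f V)) = (\<Sum>a\<in>set V. count_list V a * length (f a))"
  by (simp add: length_concat sum_list_map_eq_sum_count comp_def)

section \<open>Random words and their factors\<close>

lemma finite_words_of_length [simp]: "finite (words_of_length q n)"
  unfolding words_of_length_def by (rule finite_lists_length_eq) simp

lemma card_words_of_length [simp]: "card (words_of_length q n) = q ^ n"
  unfolding words_of_length_def by (simp add: card_lists_length_eq)

lemma words_of_length_nonempty:
  assumes "q \<ge> 1"
  shows "words_of_length q n \<noteq> {}"
proof
  assume "words_of_length q n = {}"
  then have "q ^ n = 0" using card_words_of_length[of q n] by simp
  then show False using assms by simp
qed

definition instance_prob :: "'a list \<Rightarrow> nat \<Rightarrow> nat \<Rightarrow> real" where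
  "instance_prob V q m = real (card {U \<in> words_of_length q m. word_instance V U}) / real q ^ m"

lemma instance_prob_nonneg: "instance_prob V q m \<ge> 0"
  by (simp add: instance_prob_def)

text \<open>A word with a prescribed property of the factor between positions \<open>i\<close> and \<open>j\<close> is an arbitrary
  prefix, a factor with the property and an arbitrary suffix.\<close>

lemma card_words_with_factor:
  assumes "i < j" "j \<le> n"
  shows "card {W \<in> words_of_length q n. P (word_factor W i j)}
       = q ^ (n - (j - i)) * card {U \<in> words_of_length q (j - i). P U}"
proof -
  let ?A = "words_of_length q i" and ?C = "words_of_length q (n - j)"
  let ?B = "{U \<in> words_of_length q (j - i). P U}"
  let ?D = "{W \<in> words_of_length q n. P (word_factor W i j)}"
  have "bij_betw (\<lambda>(X, U, Y). X @ U @ Y) (?A \<times> ?B \<times> ?C) ?D"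
  proof (rule bij_betw_byWitness[where f' = "\<lambda>W. (take i W, word_factor W i j, drop j W)"])
    show "\<forall>Z\<in>?A \<times> ?B \<times> ?C. (case (case Z of (X, U, Y) \<Rightarrow> X @ U @ Y) of
        W \<Rightarrow> (take i W, word_factor W i j, drop j W)) = Z"
      using assms by (auto simp: words_of_length_def word_factor_def)
    show "\<forall>W\<in>?D. (case (take i W, word_factor W i j, drop j W) of (X, U, Y) \<Rightarrow> X @ U @ Y) = W"
    proof
      fix W assume "W \<in> ?D"
      have "word_factor W i j @ drop j W = drop i W"
        using assms append_take_drop_id[of "j - i" "drop i W"] by (simp add: word_factor_def)
      then show "(case (take i W, word_factor W i j, drop j W) of (X, U, Y) \<Rightarrow> X @ U @ Y) = W"
        by simp
    qed
    show "(\<lambda>(X, U, Y). X @ U @ Y) ` (?A \<times> ?B \<times> ?C) \<subseteq> ?D"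
    proof (rule image_subsetI)
      fix Z assume "Z \<in> ?A \<times> ?B \<times> ?C"
      then obtain X U Y where Z: "Z = (X, U, Y)" and XUY: "X \<in> ?A" "U \<in> ?B" "Y \<in> ?C"
        by (elim SigmaE) simp
      have "word_factor (X @ U @ Y) i j = U"
        using XUY by (simp add: word_factor_def words_of_length_def)
      then show "(case Z of (X, U, Y) \<Rightarrow> X @ U @ Y) \<in> ?D"
        using XUY assms by (simp add: Z words_of_length_def)
    qed
    show "(\<lambda>W. (take i W, word_factor W i j, drop j W)) ` ?D \<subseteq> ?A \<times> ?B \<times> ?C"
    proof (rule image_subsetI)
      fix W assume W: "W \<in> ?D"
      have "set (take i W) \<subseteq> set W" "set (word_factor W i j) \<subseteq> set W" "set (drop j W) \<subseteq> set W"
        using set_take_subset[of i W] set_drop_subset[of j W]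
          subset_trans[OF set_take_subset set_drop_subset, of "j - i" i W]
        by (simp_all add: word_factor_def)
      moreover have "set W \<subseteq> {1..q}" using W by (simp add: words_of_length_def)
      ultimately have "set (take i W) \<subseteq> {1..q}" "set (word_factor W i j) \<subseteq> {1..q}"
        "set (drop j W) \<subseteq> {1..q}"
        by blast+
      then show "(take i W, word_factor W i j, drop j W) \<in> ?A \<times> ?B \<times> ?C"
        using W assms unfolding words_of_length_def by (simp add: word_factor_def)
    qed
  qed
  then have "card ?D = card (?A \<times> ?B \<times> ?C)" by (rule bij_betw_same_card[symmetric])
  also have "\<dots> = q ^ (i + (n - j)) * card ?B"
    by (simp only: card_cartesian_product card_words_of_length power_add mult_ac)
  also have "i + (n - j) = n - (j - i)" using assms by simp
  finally show ?thesis .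
qed

lemma factor_instance_prob:
  assumes "i < j" "j \<le> n" "q \<ge> 1"
  shows "real (card {W \<in> words_of_length q n. word_instance V (word_factor W i j)}) / real q ^ n
       = instance_prob V q (j - i)"
proof -
  have "real q ^ n = real q ^ (n - (j - i)) * real q ^ (j - i)"
    using assms by (simp flip: power_add)
  then show ?thesis
    using assms by (simp add: card_words_with_factor instance_prob_def)
qed

abbreviation factor_positions :: "nat \<Rightarrow> (nat \<times> nat) set" where
  "factor_positions n \<equiv> {(i, j). i < j \<and> j \<le> n}"

lemma finite_factor_positions: "finite (factor_positions n)"
  by (rule finite_subset[of _ "{..n} \<times> {..n}"]) auto

lemma real_Suc_choose_two: "real ((n + 1) choose 2) = (real n + 1) * real n / 2"
  by (induction n) (auto simp: numeral_2_eq_2 field_simps)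

text \<open>Linearity of expectation: exchange the sum over words with the sum over positions.\<close>

lemma expected_density_eq_avg:
  assumes "q \<ge> 1"
  shows "expected_density V q n =
    (\<Sum>(i, j)\<in>factor_positions n. instance_prob V q (j - i)) / real ((n + 1) choose 2)"
proof -
  let ?W = "words_of_length q n" and ?P = "factor_positions n" and ?c = "real ((n + 1) choose 2)"
  let ?h = "\<lambda>W p. if word_instance V (word_factor W (fst p) (snd p)) then 1 else 0 :: real"
  have dens: "word_density V W = (\<Sum>p\<in>?P. ?h W p) / ?c" if "W \<in> ?W" for W
  proof -
    have "{(i, j). i < j \<and> j \<le> length W \<and> word_instance V (word_factor W i j)}
        = {p \<in> ?P. word_instance V (word_factor W (fst p) (snd p))}"
      using that by (auto simp: words_of_length_def)
    moreover have "length W = n" using that by (simp add: words_of_length_def)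
    ultimately show ?thesis
      using finite_factor_positions[of n]
      by (simp add: word_density_def sum.If_cases Int_def)
  qed
  have "expected_density V q n = (\<Sum>W\<in>?W. word_density V W) / real q ^ n"
    unfolding expected_density_def
    using words_of_length_nonempty[OF assms] by (simp add: integral_pmf_of_set)
  also have "\<dots> = (\<Sum>W\<in>?W. (\<Sum>p\<in>?P. ?h W p) / ?c) / real q ^ n"
    using dens by simp
  also have "\<dots> = (\<Sum>W\<in>?W. \<Sum>p\<in>?P. ?h W p) / real q ^ n / ?c"
    by (simp add: sum_divide_distrib mult.commute)
  also have "(\<Sum>W\<in>?W. \<Sum>p\<in>?P. ?h W p) = (\<Sum>p\<in>?P. \<Sum>W\<in>?W. ?h W p)"
    by (rule sum.swap)
  also have "\<dots> / real q ^ n = (\<Sum>p\<in>?P. (\<Sum>W\<in>?W. ?h W p) / real q ^ n)"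
    by (rule sum_divide_distrib)
  also have "\<dots> = (\<Sum>(i, j)\<in>?P. instance_prob V q (j - i))"
  proof (rule sum.cong[OF refl])
    fix p assume "p \<in> ?P"
    then obtain i j where p: "p = (i, j)" "i < j" "j \<le> n" by auto
    have "(\<Sum>W\<in>?W. ?h W p) = real (card {W \<in> ?W. word_instance V (word_factor W i j)})"
      by (simp add: p sum.If_cases Int_def)
    then show "(\<Sum>W\<in>?W. ?h W p) / real q ^ n = (case p of (i, j) \<Rightarrow> instance_prob V q (j - i))"
      using factor_instance_prob[OF p(2,3) assms] p(1) by simp
  qed
  finally show ?thesis .
qed

section \<open>Doubled words\<close>

lemma sum_words_by_length:
  fixes g :: "nat list \<Rightarrow> real"
  shows "(\<Sum>U\<in>(\<Union>m\<in>{1..n}. words_of_length q m). g U)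
       = (\<Sum>m=1..n. \<Sum>U\<in>words_of_length q m. g U)"
  by (rule sum.UNION_disjoint) (auto simp: words_of_length_def finite_lists_length_eq)

lemma sum_half_powers_le_1: "(\<Sum>m=1..n. (1/2::real) ^ m) \<le> 1"
proof -
  have "(\<Sum>m=1..n. (1/2::real) ^ m) = 1 - (1/2) ^ n"
    by (induction n) auto
  then show ?thesis by simp
qed

text \<open>This bounds the contribution of a letter occurring twice: the \<open>q ^ m\<close> words of length \<open>m\<close> that may
  replace it have weight \<open>(1/q) ^ (2 * m)\<close> each, which leaves a geometric series with ratio
  \<open>1/q \<le> 1/2\<close>.\<close>

lemma sum_words_squared_weight_le_1:
  assumes "q \<ge> 2"
  shows "(\<Sum>U\<in>(\<Union>m\<in>{1..n}. words_of_length q m). (1 / real q) ^ (2 * length U)) \<le> 1"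
proof -
  have "(\<Sum>U\<in>words_of_length q m. (1 / real q) ^ (2 * length U)) = (1 / real q) ^ m" for m
  proof -
    have "(\<Sum>U\<in>words_of_length q m. (1 / real q) ^ (2 * length U))
        = (\<Sum>U\<in>words_of_length q m. (1 / real q) ^ (2 * m))"
      by (rule sum.cong) (auto simp: words_of_length_def)
    also have "\<dots> = real q ^ m * ((1 / real q) ^ m * (1 / real q) ^ m)"
      by (simp add: mult_2 power_add)
    also have "\<dots> = (1 / real q) ^ m"
      using assms by (simp add: power_divide)
    finally show ?thesis .
  qed
  then have "(\<Sum>U\<in>(\<Union>m\<in>{1..n}. words_of_length q m). (1 / real q) ^ (2 * length U))
      = (\<Sum>m=1..n. (1 / real q) ^ m)"
    by (simp only: sum_words_by_length)
  also have "\<dots> \<le> (\<Sum>m=1..n. (1/2) ^ m)"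
    using assms by (intro sum_mono power_mono) (auto simp: field_simps)
  also have "\<dots> \<le> 1" by (rule sum_half_powers_le_1)
  finally show ?thesis .
qed

text \<open>Passing from instances to substitutions can only increase the sum, because an instance may
  arise from several substitutions; in exchange, the sum over all substitutions is a product over
  the letters of \<open>V\<close>.\<close>

lemma doubled_imp_sum_instance_prob_le_1:
  assumes "doubled V" "q \<ge> 2"
  shows "(\<Sum>m=1..n. instance_prob V q m) \<le> 1"
proof -
  define r where "r = 1 / real q"
  define X where "X = (\<Union>m\<in>{1..n}. words_of_length q m)"
  define F where "F = PiE (set V) (\<lambda>_. X)"
  let ?sub = "\<lambda>f. concat (map f V)"
  have r: "0 \<le> r" "r \<le> 1" using assms(2) by (auto simp: r_def)
  have finX: "finite X" by (auto simp: X_def)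
  then have finF: "finite F" by (auto simp: F_def intro: finite_PiE)
  have "(\<Sum>m=1..n. instance_prob V q m)
      = (\<Sum>m=1..n. \<Sum>U\<in>words_of_length q m. if word_instance V U then r ^ length U else 0)"
  proof (rule sum.cong[OF refl])
    fix m
    have "(\<Sum>U\<in>words_of_length q m. if word_instance V U then r ^ length U else 0)
        = (\<Sum>U\<in>words_of_length q m. if word_instance V U then r ^ m else 0)"
      by (rule sum.cong) (auto simp: words_of_length_def)
    also have "\<dots> = real (card {U \<in> words_of_length q m. word_instance V U}) * r ^ m"
      by (simp add: sum.If_cases Int_def)
    also have "\<dots> = instance_prob V q m"
      by (simp add: instance_prob_def r_def power_divide)
    finally show "instance_prob V q m
        = (\<Sum>U\<in>words_of_length q m. if word_instance V U then r ^ length U else 0)" by simp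
  qed
  also have "\<dots> = (\<Sum>U\<in>X. if word_instance V U then r ^ length U else 0)"
    by (simp only: sum_words_by_length X_def)
  also have "\<dots> = (\<Sum>U\<in>{U \<in> X. word_instance V U}. r ^ length U)"
    using finX by (simp add: sum.If_cases Int_def)
  also have "\<dots> \<le> (\<Sum>U\<in>?sub ` F. r ^ length U)"
  proof (rule sum_mono2)
    show "{U \<in> X. word_instance V U} \<subseteq> ?sub ` F"
    proof
      fix U assume "U \<in> {U \<in> X. word_instance V U}"
      then obtain f where UX: "U \<in> X" and f: "\<And>a. f a \<noteq> []" "U = ?sub f"
        by (auto simp: word_instance_iff)
      have "f a \<in> X" if "a \<in> set V" for a
      proof -
        obtain A B where "V = A @ a # B" using \<open>a \<in> set V\<close> by (auto dest: split_list)
        then have U: "U = concat (map f A) @ f a @ concat (map f B)" by (simp add: f(2))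
        then have "set (f a) \<subseteq> {1..q}" "length (f a) \<le> n"
          using UX by (auto simp: X_def words_of_length_def)
        moreover have "1 \<le> length (f a)" using f(1)[of a] by (simp add: Suc_le_eq)
        ultimately show ?thesis by (auto simp: X_def words_of_length_def)
      qed
      then have "restrict f (set V) \<in> F" by (auto simp: F_def)
      moreover have "U = ?sub (restrict f (set V))"
        by (simp add: f(2) cong: map_cong)
      ultimately show "U \<in> ?sub ` F" by blast
    qed
  qed (use finF r in auto)
  also have "\<dots> \<le> (\<Sum>f\<in>F. r ^ length (?sub f))"
    using sum_image_le[of F "\<lambda>U. r ^ length U" ?sub] finF r by (simp add: comp_def)
  also have "\<dots> \<le> (\<Sum>f\<in>F. \<Prod>a\<in>set V. r ^ (2 * length (f a)))"
  proof (rule sum_mono)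
    fix f :: "'a \<Rightarrow> nat list"
    have "r ^ length (?sub f) = (\<Prod>a\<in>set V. r ^ (count_list V a * length (f a)))"
      by (simp add: length_concat_map power_sum)
    also have "\<dots> \<le> (\<Prod>a\<in>set V. r ^ (2 * length (f a)))"
      using assms(1) r
      by (intro prod_mono conjI power_decreasing mult_right_mono) (auto simp: doubled_def)
    finally show "r ^ length (?sub f) \<le> (\<Prod>a\<in>set V. r ^ (2 * length (f a)))" .
  qed
  also have "\<dots> = (\<Prod>a\<in>set V. \<Sum>U\<in>X. r ^ (2 * length U))"
    unfolding F_def using finX by (subst prod_sum_PiE) auto
  also have "\<dots> \<le> 1"
    using sum_words_squared_weight_le_1[OF assms(2), of n] r
    by (intro prod_le_1) (auto simp: X_def r_def intro!: sum_nonneg)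
  finally show ?thesis .
qed

lemma doubled_imp_expected_density_le:
  assumes "doubled V" "q \<ge> 2" "n \<ge> 1"
  shows "expected_density V q n \<le> 2 / (real n + 1)"
proof -
  have pos: "factor_positions n = (SIGMA i:{..<n}. {i<..n})" by auto
  have "(\<Sum>(i, j)\<in>factor_positions n. instance_prob V q (j - i))
      = (\<Sum>i<n. \<Sum>j\<in>{i<..n}. instance_prob V q (j - i))"
    unfolding pos by (rule sum.Sigma[symmetric]) auto
  also have "\<dots> \<le> (\<Sum>i<n. 1)"
  proof (rule sum_mono)
    fix i assume "i \<in> {..<n}"
    have "(\<Sum>j\<in>{i<..n}. instance_prob V q (j - i)) = (\<Sum>m=1..n-i. instance_prob V q m)"
      by (rule sum.reindex_bij_witness[of _ "\<lambda>m. m + i" "\<lambda>j. j - i"]) auto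
    also have "\<dots> \<le> 1" by (rule doubled_imp_sum_instance_prob_le_1[OF assms(1,2)])
    finally show "(\<Sum>j\<in>{i<..n}. instance_prob V q (j - i)) \<le> 1" .
  qed
  also have "\<dots> = real n" by simp
  finally have "(\<Sum>(i, j)\<in>factor_positions n. instance_prob V q (j - i)) \<le> real n" .
  then have "expected_density V q n \<le> real n / real ((n + 1) choose 2)"
    using assms(2) by (simp add: expected_density_eq_avg divide_right_mono)
  also have "real ((n + 1) choose 2) = (real n + 1) * real n / 2"
    by (rule real_Suc_choose_two)
  also have "real n / ((real n + 1) * real n / 2) = 2 / (real n + 1)"
    using assms(3) by simp
  finally show ?thesis .
qed

section \<open>Words with a letter that occurs once\<close>

text \<open>All letters but the one occurring once are replaced by the one-letter word \<open>[1]\<close>, and the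
  image of the remaining letter is arbitrary, so only \<open>length V - 1\<close> letters of the resulting
  instance are prescribed.\<close>

lemma not_doubled_imp_instance_prob_ge:
  assumes "\<not> doubled V" "q \<ge> 1" "m \<ge> length V"
  shows "instance_prob V q m \<ge> (1 / real q) ^ length V"
proof -
  obtain a where a: "a \<in> set V" "count_list V a < 2"
    using assms(1) by (auto simp: doubled_def not_le)
  then obtain A B where V: "V = A @ a # B" by (auto dest: split_list)
  have notin: "a \<notin> set A" "a \<notin> set B"
    using a(2) by (auto simp: V count_list_0_iff)
  define l where "l = m - (length V - 1)"
  have l: "1 \<le> l" "m = length A + l + length B" "m + 1 = l + length V"
    using assms(3) by (auto simp: l_def V)
  let ?g = "\<lambda>X. replicate (length A) 1 @ X @ replicate (length B) (1::nat)"
  have sub: "?g ` words_of_length q l \<subseteq> {U \<in> words_of_length q m. word_instance V U}"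
  proof clarify
    fix X assume X: "X \<in> words_of_length q l"
    let ?f = "\<lambda>b. if b = a then X else [1]"
    have "X \<noteq> []" using X l(1) by (auto simp: words_of_length_def)
    moreover have ones: "concat (map ?f C) = replicate (length C) 1" if "a \<notin> set C" for C
      using that by (induction C) auto
    have "?g X = concat (map ?f V)"
      by (simp add: V ones[OF notin(1)] ones[OF notin(2)])
    ultimately have "word_instance V (?g X)"
      unfolding word_instance_iff by (intro exI[of _ ?f]) auto
    moreover have "?g X \<in> words_of_length q m"
      using X assms(2) by (auto simp: words_of_length_def l(2))
    ultimately show "?g X \<in> words_of_length q m \<and> word_instance V (?g X)" by blast
  qed
  have "card (?g ` words_of_length q l) = q ^ l"
    by (subst card_image) (auto simp: inj_on_def)
  then have "q ^ l \<le> card {U \<in> words_of_length q m. word_instance V U}"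
    using card_mono[OF _ sub] by simp
  then have "real q ^ l / real q ^ m \<le> instance_prob V q m"
    unfolding instance_prob_def by (intro divide_right_mono) (simp_all flip: of_nat_power)
  moreover have "(1 / real q) ^ length V \<le> real q ^ l / real q ^ m"
  proof -
    have "real q ^ m \<le> real q ^ (l + length V)"
      using assms(2) l(3) by (intro power_increasing) auto
    then show ?thesis using assms(2) by (simp add: field_simps power_add power_divide)
  qed
  ultimately show ?thesis by linarith
qed

text \<open>In a word of length \<open>3 * N\<close>, the \<open>N\<^sup>2\<close> factors that start in the first third and end in the last
  third have length at least \<open>N\<close>, and they are at least a sixth of all factors.\<close>

lemma not_doubled_imp_expected_density_ge:
  assumes "\<not> doubled V" "q \<ge> 1" "N \<ge> length V" "N \<ge> 1"
  shows "expected_density V q (3 * N) \<ge> (1 / real q) ^ length V / 6"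
proof -
  define c where "c = (1 / real q) ^ length V"
  have c: "c \<ge> 0" by (simp add: c_def)
  let ?P = "factor_positions (3 * N)"
  have "real N * real N * c = (\<Sum>(i, j)\<in>{..<N} \<times> {2 * N<..3 * N}. c)"
    by (simp add: card_cartesian_product)
  also have "\<dots> \<le> (\<Sum>(i, j)\<in>{..<N} \<times> {2 * N<..3 * N}. instance_prob V q (j - i))"
  proof (rule sum_mono)
    fix p assume "p \<in> {..<N} \<times> {2 * N<..3 * N}"
    then obtain i j where p: "p = (i, j)" "i < N" "2 * N < j" by auto
    then have "j - i \<ge> length V" using assms(3) by linarith
    then have "c \<le> instance_prob V q (j - i)"
      unfolding c_def by (rule not_doubled_imp_instance_prob_ge[OF assms(1,2)])
    then show "(case p of (i, j) \<Rightarrow> c) \<le> (case p of (i, j) \<Rightarrow> instance_prob V q (j - i))"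
      by (simp add: p(1))
  qed
  also have "\<dots> \<le> (\<Sum>(i, j)\<in>?P. instance_prob V q (j - i))"
    by (rule sum_mono2) (auto simp: finite_factor_positions instance_prob_nonneg)
  finally have *: "real N * real N * c / real ((3 * N + 1) choose 2) \<le> expected_density V q (3 * N)"
    using assms(2) by (simp add: expected_density_eq_avg divide_right_mono)
  have choose: "real ((3 * N + 1) choose 2) = (3 * real N + 1) * (3 * real N) / 2"
    using real_Suc_choose_two[of "3 * N"] by simp
  have "(3 * real N + 1) * (3 * real N) / 2 \<le> 6 * (real N * real N)"
    using assms(4) mult_right_mono[of 1 "real N" "real N"] by (simp add: field_simps)
  then have "real N * real N * c / (6 * (real N * real N))
      \<le> real N * real N * c / ((3 * real N + 1) * (3 * real N) / 2)"
    using assms(4) c by (intro divide_left_mono) auto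
  moreover have "real N * real N * c / (6 * (real N * real N)) = c / 6"
    using assms(4) by simp
  ultimately show ?thesis using *[unfolded choose] unfolding c_def by linarith
qed

section \<open>The characterization\<close>

theorem theorem4p4:
  fixes V :: "'a list" and q :: nat
  assumes "V \<noteq> []" and "q \<ge> 2"
  shows "doubled V \<longleftrightarrow> (\<lambda>n. expected_density V q n) \<longlonglongrightarrow> 0"
proof
  assume V: "doubled V"
  show "(\<lambda>n. expected_density V q n) \<longlonglongrightarrow> 0"
  proof (rule real_tendsto_sandwich)
    have "expected_density V q n \<ge> 0" for n
      using assms(2)
      by (auto simp: expected_density_eq_avg instance_prob_nonneg intro!: divide_nonneg_nonneg sum_nonneg)
    then show "\<forall>\<^sub>F n in sequentially. 0 \<le> expected_density V q n" by simp
    show "\<forall>\<^sub>F n in sequentially. expected_density V q n \<le> 2 / (real n + 1)"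
      using eventually_ge_at_top[of 1]
      by eventually_elim (rule doubled_imp_expected_density_le[OF V assms(2)])
    show "(\<lambda>n. 2 / (real n + 1)) \<longlonglongrightarrow> 0"
      using tendsto_mult_right_zero[OF LIMSEQ_inverse_real_of_nat, of 2]
      by (simp add: divide_inverse add.commute)
  qed simp
next
  assume lim: "(\<lambda>n. expected_density V q n) \<longlonglongrightarrow> 0"
  show "doubled V"
  proof (rule ccontr)
    assume V: "\<not> doubled V"
    have "(\<lambda>N. expected_density V q (3 * N)) \<longlonglongrightarrow> 0"
      using LIMSEQ_subseq_LIMSEQ[OF lim, of "\<lambda>N. 3 * N"] by (simp add: strict_mono_def comp_def)
    moreover have "\<forall>N\<ge>max 1 (length V). (1 / real q) ^ length V / 6 \<le> expected_density V q (3 * N)"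
      using not_doubled_imp_expected_density_ge[OF V] assms(2) by simp
    ultimately have "(1 / real q) ^ length V / 6 \<le> 0"
      by (meson LIMSEQ_le_const)
    moreover have "(1 / real q) ^ length V / 6 > 0" using assms(2) by simp
    ultimately show False by linarith
  qed
qed

end
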